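(* For any positive integer $n$, the following equalities hold for the graph $Q_n$ of the $n$-dimensional cube: $$ \mu_{11}(Q_n)=3-\min\{3,n\}, \qquad \mu_{12}(Q_n)=\mu_{22}(Q_n)=2^n, $$ $$ \mu_{21}(Q_n)=2^{n-1}+\left\lceil 1-\frac{\min\{4,n\}}{4}\right\rceil. $$
   Context: Graphs are finite, undirected, connected, without loops and multiple edges, and contain at least one edge. $V(G)$ and $E(G)$ denote the vertex set and edge set of $G$. $Q_n$ is the graph of the $n$-dimensional cube (vertices are the binary strings of length $n$, two being adjacent iff they differ in exactly one coordinate), so $|V(Q_n)|=2^n$ and $|E(Q_n)|=n\cdot 2^{n-1}$. An interval is a nonempty finite set of consecutive integers. A proper edge $t$-coloring of $G$ is a function $\varphi:E(G)\to\{1,\dots,t\}$ such that adjacent edges receive different colors and each of the $t$ colors is used. $\chi'(G)$ is the least $t$ for which a proper edge $t$-coloring of $G$ exists. For an integer $t$ with $\chi'(G)\le t\le |E(G)|$, $\alpha(G,t)$ is the set of all proper edge $t$-colorings of $G$, and $\alpha(G)=\bigcup_{t=\chi'(G)}^{|E(G)|}\alpha(G,t)$. For $\varphi\in\alpha(G)$ and $x\in V(G)$, the spectrum $S_G(x,\varphi)$ is the set of colors of the edges incident with $x$. Set $f_G(\varphi)=|\{x\in V(G): S_G(x,\varphi)\text{ is an interval}\}|$. For an integer $t$ with $\chi'(G)\le t\le |E(G)|$, set $$\mu_1(G,t)=\min_{\varphi\in\alpha(G,t)}f_G(\varphi),\qquad \mu_2(G,t)=\max_{\varphi\in\alpha(G,t)}f_G(\varphi),$$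 and, with $t$ ranging over all integers satisfying $\chi'(G)\le t\le|E(G)|$, $$\mu_{11}(G)=\min_t\mu_1(G,t),\quad \mu_{12}(G)=\max_t\mu_1(G,t),\quad \mu_{21}(G)=\min_t\mu_2(G,t),\quad \mu_{22}(G)=\max_t\mu_2(G,t).$$ *)

theory Defs
  imports Complex_Main "HOL-Library.FuncSet"
begin

text \<open>An edge is the two-element set of its endpoints.\<close>

record 'a ugraph =
  verts :: "'a set"
  edges :: "'a set set"

definition is_int_interval :: "nat set \<Rightarrow> bool" where
  "is_int_interval S \<longleftrightarrow> (\<exists>a b. a \<le> b \<and> S = {a..b})"

text \<open>Colorings are extensional functions on the edge set, so that two colorings are equal
  iff they agree on all edges and \<open>\<alpha>(G,t)\<close> is a finite set for finite \<open>G\<close>.\<close>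

definition colorings :: "'a ugraph \<Rightarrow> nat \<Rightarrow> ('a set \<Rightarrow> nat) set" where
  "colorings G t = {\<phi> \<in> edges G \<rightarrow>\<^sub>E {1..t}.
     (\<forall>e\<in>edges G. \<forall>e'\<in>edges G. e \<noteq> e' \<and> e \<inter> e' \<noteq> {} \<longrightarrow> \<phi> e \<noteq> \<phi> e') \<and>
     \<phi> ` edges G = {1..t}}"

definition chromatic_index :: "'a ugraph \<Rightarrow> nat" where
  "chromatic_index G = (LEAST t. colorings G t \<noteq> {})"

definition spectrum :: "'a ugraph \<Rightarrow> 'a \<Rightarrow> ('a set \<Rightarrow> nat) \<Rightarrow> nat set" where
  "spectrum G x \<phi> = \<phi> ` {e \<in> edges G. x \<in> e}"

definition interval_count :: "'a ugraph \<Rightarrow> ('a set \<Rightarrow> nat) \<Rightarrow> nat" where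
  "interval_count G \<phi> = card {x \<in> verts G. is_int_interval (spectrum G x \<phi>)}"

text \<open>For a finite graph with an edge, \<open>Min\<close> and \<open>Max\<close> below are taken over finite nonempty sets
  whenever \<open>\<chi>'(G) \<le> t \<le> |E(G)|\<close>: if \<open>t < |E(G)|\<close>, a \<open>t\<close>-coloring uses some color twice, and
  giving one of these edges a new color yields a \<open>(t + 1)\<close>-coloring.\<close>

definition mu1 :: "'a ugraph \<Rightarrow> nat \<Rightarrow> nat" where
  "mu1 G t = Min (interval_count G ` colorings G t)"

definition mu2 :: "'a ugraph \<Rightarrow> nat \<Rightarrow> nat" where
  "mu2 G t = Max (interval_count G ` colorings G t)"

definition mu11 :: "'a ugraph \<Rightarrow> nat" where
  "mu11 G = Min (mu1 G ` {chromatic_index G..card (edges G)})"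

definition mu12 :: "'a ugraph \<Rightarrow> nat" where
  "mu12 G = Max (mu1 G ` {chromatic_index G..card (edges G)})"

definition mu21 :: "'a ugraph \<Rightarrow> nat" where
  "mu21 G = Min (mu2 G ` {chromatic_index G..card (edges G)})"

definition mu22 :: "'a ugraph \<Rightarrow> nat" where
  "mu22 G = Max (mu2 G ` {chromatic_index G..card (edges G)})"

definition cube :: "nat \<Rightarrow> bool list ugraph" where
  "cube n = \<lparr>verts = {x. length x = n},
     edges = {{x, y} | x y. length x = n \<and> length y = n \<and> card {i. i < n \<and> x ! i \<noteq> y ! i} = 1}\<rparr>"

end

theory Submission
  imports Defs
begin

text \<open>
  At every vertex of the cube the \<open>n\<close> incident edges have distinct colors, so at least \<open>n\<close> colors
  are needed; \<open>n\<close> colors suffice, and with exactly \<open>n\<close> colors every spectrum is \<open>{1..n}\<close>. This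
  settles \<open>mu12\<close> and \<open>mu22\<close>, and shows that the chromatic index is \<open>n\<close>.

  For \<open>mu11\<close> and \<open>n \<ge> 3\<close> there is a coloring with \<open>n + 1\<close> colors in which each vertex sees \<open>1\<close> and
  \<open>n + 1\<close> but misses a color in between (\<open>interval_free_coloring\<close>). On the square the edge of color
  \<open>2\<close> always has a neighboring edge of color \<open>1\<close> or \<open>3\<close>.

  The substance is in \<open>mu21\<close>. Its value is the maximum number of interval vertices in a rainbow
  coloring, one whose edges all have different colors.

  Upper bound: in a rainbow coloring the spectra of two adjacent interval vertices are intervals of
  length \<open>n\<close> that share exactly one color, so one lies above the other and they meet in an endpoint.
  Order the interval vertices by the least color they see. An interval vertex with two interval
  neighbors then lies strictly between them, because both of its extreme colors are used. Hence the
  interval vertices have at most two interval neighbors each and contain no cycle: they induce a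
  linear forest (\<open>rainbow_ranked_linear_forest\<close>). Such a set has at most three of the four vertices
  of a square and at most five of the eight vertices of a 3-cube. If it has five in a 3-cube then
  they form a path, and the neighboring parallel 3-cube contains at most three
  (\<open>subcube_3_bound\<close>). So a 4-cube contains at most eight, and a larger cube, being a disjoint union
  of 4-cubes, at most half of its vertices.

  Lower bound: for every \<open>t\<close> from \<open>n\<close> to the number of edges some \<open>t\<close>-coloring has as many interval
  vertices. It is enough to have one such rainbow coloring in which the color of an edge modulo \<open>n\<close>
  depends only on its direction. Replacing each color above \<open>t\<close> by the color in the top window
  \<open>{t + 1 - n..t}\<close> with the same residue keeps the coloring proper, and it maps intervals of length
  \<open>n\<close> to intervals (\<open>fold_color_interval\<close>). If the edges at the \<open>k\<close>-th vertex of even weight receive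
  the \<open>k\<close>-th block of \<open>n\<close> consecutive colors, half of the vertices are interval vertices. For
  \<open>n \<le> 3\<close> one more is obtained by numbering the edges of each direction along a Gray code, which
  makes consecutive vertices of a path see intervals that overlap in one color.
\<close>

section \<open>The cube through coordinate flips\<close>

text \<open>With out-of-range positions acting trivially, the flips are commuting involutions without side
  conditions; \<open>flip_commute\<close> and \<open>flip_flip\<close> therefore bring every product of flips to a normal form.\<close>
definition flip :: "nat \<Rightarrow> bool list \<Rightarrow> bool list" where
  "flip i x = x[i := \<not> x ! i]"

lemma length_flip [simp]: "length (flip i x) = length x"
  by (simp add: flip_def)

lemma flip_flip [simp]: "flip i (flip i x) = x"
  by (cases "i < length x") (simp_all add: flip_def list_update_beyond)

lemma flip_commute: "flip i (flip j x) = flip j (flip i x)"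
  by (cases "i = j") (simp_all add: flip_def list_update_swap)

lemma nth_flip: "i < length x \<Longrightarrow> flip j x ! i = (if i = j then \<not> x ! i else x ! i)"
  by (simp add: flip_def nth_list_update)

lemma flip_Cons_0 [simp]: "flip 0 (a # x) = (\<not> a) # x"
  by (simp add: flip_def)

lemma flip_Cons_Suc [simp]: "flip (Suc i) (a # x) = a # flip i x"
  by (simp add: flip_def)

lemma flip_neq: "i < length x \<Longrightarrow> flip i x \<noteq> x"
  by (metis nth_flip)

lemma flip_index_unique: "i < length x \<Longrightarrow> flip i x = flip j x \<Longrightarrow> i = j"
  by (metis nth_flip)

lemma verts_cube [simp]: "verts (cube n) = {x. length x = n}"
  by (simp add: cube_def)

lemma edges_cube: "edges (cube n) = {{x, flip i x} | x i. length x = n \<and> i < n}"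
proof (intro subset_antisym subsetI)
  fix e assume "e \<in> edges (cube n)"
  then obtain x y where e: "e = {x, y}" and len: "length x = n" "length y = n"
    and "card {i. i < n \<and> x ! i \<noteq> y ! i} = 1"
    by (auto simp: cube_def)
  then obtain i where i: "{i. i < n \<and> x ! i \<noteq> y ! i} = {i}"
    by (meson card_1_singletonE)
  have "y = flip i x"
    using i len by (intro nth_equalityI) (auto simp: nth_flip)
  moreover have "i < n" using i by auto
  ultimately show "e \<in> {{x, flip i x} | x i. length x = n \<and> i < n}"
    using e len by blast
next
  fix e assume "e \<in> {{x, flip i x} | x i. length x = n \<and> i < n}"
  then obtain x i where e: "e = {x, flip i x}" "length x = n" "i < n" by blast
  then have "{j. j < n \<and> x ! j \<noteq> flip i x ! j} = {i}"
    by (auto simp: nth_flip split: if_splits)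
  then have "card {j. j < n \<and> x ! j \<noteq> flip i x ! j} = 1" by simp
  then show "e \<in> edges (cube n)"
    using e length_flip[of i x] unfolding cube_def
    by (simp only: ugraph.simps mem_Collect_eq) blast
qed

lemma edge_in_cube: "length x = n \<Longrightarrow> i < n \<Longrightarrow> {x, flip i x} \<in> edges (cube n)"
  by (auto simp: edges_cube)

lemma edge_eq_iff:
  assumes "i < length x" "i' < length y"
  shows "{x, flip i x} = {y, flip i' y} \<longleftrightarrow> i = i' \<and> (y = x \<or> y = flip i x)"
proof
  assume "{x, flip i x} = {y, flip i' y}"
  then have "y = x \<and> flip i x = flip i' x \<or> y = flip i x \<and> flip i' y = x"
    by (auto simp: doubleton_eq_iff)
  then show "i = i' \<and> (y = x \<or> y = flip i x)"
    using assms flip_index_unique[of i x i'] flip_index_unique[of i' y i] by auto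
qed auto

lemma edges_at_vertex:
  assumes "length x = n"
  shows "{e \<in> edges (cube n). x \<in> e} = (\<lambda>i. {x, flip i x}) ` {..<n}"
proof (intro subset_antisym subsetI)
  fix e assume "e \<in> {e \<in> edges (cube n). x \<in> e}"
  then obtain y i where e: "e = {y, flip i y}" "i < n" "x = y \<or> x = flip i y"
    by (auto simp: edges_cube)
  then have "e = {x, flip i x}" by auto
  then show "e \<in> (\<lambda>i. {x, flip i x}) ` {..<n}" using e by blast
qed (use assms edge_in_cube in auto)

lemma finite_vertices [simp]: "finite {x :: bool list. length x = n}"
  using finite_lists_length_eq[of "UNIV :: bool set" n] by simp

lemma card_vertices: "card {x :: bool list. length x = n} = 2 ^ n"
  using card_lists_length_eq[of "UNIV :: bool set" n] by simp

lemma finite_edges [simp]: "finite (edges (cube n))"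
proof -
  have "edges (cube n) \<subseteq> Pow {x. length x = n}" by (auto simp: edges_cube)
  then show ?thesis by (rule finite_subset) simp
qed

primrec odd_weight :: "bool list \<Rightarrow> bool" where
  "odd_weight [] = False"
| "odd_weight (a # x) = (a \<noteq> odd_weight x)"

lemma odd_weight_flip: "i < length x \<Longrightarrow> odd_weight (flip i x) = (\<not> odd_weight x)"
proof (induction x arbitrary: i)
  case (Cons a x)
  then show ?case by (cases i) auto
qed simp

text \<open>The first bit of a word of even weight is determined by the rest.\<close>
lemma card_even_vertices:
  "n \<ge> 1 \<Longrightarrow> card {x. length x = n \<and> \<not> odd_weight x} = 2 ^ (n - 1)"
proof (induction n)
  case (Suc m)
  have "{x. length x = Suc m \<and> \<not> odd_weight x} = (\<lambda>y. odd_weight y # y) ` {y. length y = m}"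
    by (auto simp: length_Suc_conv)
  then show ?case
    by (simp add: card_image inj_on_def card_vertices)
qed simp

text \<open>Each edge has exactly one endpoint of even weight, and is determined by it and its direction.\<close>
lemma card_edges_cube:
  assumes "n \<ge> 1"
  shows "card (edges (cube n)) = n * 2 ^ (n - 1)"
proof -
  let ?A = "{x. length x = n \<and> \<not> odd_weight x} \<times> {..<n}"
  have "edges (cube n) = (\<lambda>(x, i). {x, flip i x}) ` ?A"
  proof (intro subset_antisym subsetI)
    fix e assume "e \<in> edges (cube n)"
    then obtain x i where e: "e = {x, flip i x}" "length x = n" "i < n"
      by (auto simp: edges_cube)
    show "e \<in> (\<lambda>(x, i). {x, flip i x}) ` ?A"
    proof (cases "odd_weight x")
      case True
      then have "(flip i x, i) \<in> ?A" using e odd_weight_flip[of i x] by simp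
      moreover have "e = (\<lambda>(x, i). {x, flip i x}) (flip i x, i)" using e by auto
      ultimately show ?thesis by (rule rev_image_eqI)
    next
      case False
      then have "(x, i) \<in> ?A" using e by simp
      moreover have "e = (\<lambda>(x, i). {x, flip i x}) (x, i)" using e by simp
      ultimately show ?thesis by (rule rev_image_eqI)
    qed
  qed (auto intro: edge_in_cube)
  moreover have "inj_on (\<lambda>(x, i). {x, flip i x}) ?A"
    using odd_weight_flip by (auto simp: inj_on_def edge_eq_iff)
  ultimately show ?thesis
    using card_even_vertices[OF assms] by (simp add: card_image card_cartesian_product)
qed

lemma spectrum_cube:
  "length x = n \<Longrightarrow> spectrum (cube n) x \<phi> = (\<lambda>i. \<phi> {x, flip i x}) ` {..<n}"
  by (simp add: spectrum_def edges_at_vertex image_image)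

section \<open>Colorings by directions\<close>

lemma coloring_meeting_edges_eq:
  assumes "\<phi> \<in> colorings G t" "e \<in> edges G" "e' \<in> edges G" "x \<in> e" "x \<in> e'" "\<phi> e = \<phi> e'"
  shows "e = e'"
proof -
  have "\<forall>e\<in>edges G. \<forall>e'\<in>edges G. e \<noteq> e' \<and> e \<inter> e' \<noteq> {} \<longrightarrow> \<phi> e \<noteq> \<phi> e'"
    using assms(1) by (simp add: colorings_def)
  then show ?thesis using assms(2-6) by (metis IntI empty_iff)
qed

lemma coloring_inj_at_vertex:
  assumes "\<phi> \<in> colorings (cube n) t" "length x = n"
  shows "inj_on (\<lambda>i. \<phi> {x, flip i x}) {..<n}"
proof (rule inj_onI)
  fix i i' assume "i \<in> {..<n}" "i' \<in> {..<n}" "\<phi> {x, flip i x} = \<phi> {x, flip i' x}"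
  then have "{x, flip i x} = {x, flip i' x}"
    using assms(2) edge_in_cube[of x n]
    by (intro coloring_meeting_edges_eq[OF assms(1), of _ _ x]) auto
  then show "i = i'"
    using \<open>i \<in> {..<n}\<close> \<open>i' \<in> {..<n}\<close> assms(2) by (simp add: edge_eq_iff)
qed

lemma card_spectrum:
  "\<phi> \<in> colorings (cube n) t \<Longrightarrow> length x = n \<Longrightarrow> card (spectrum (cube n) x \<phi>) = n"
  using coloring_inj_at_vertex by (simp add: spectrum_cube card_image)

lemma spectrum_subset:
  "\<phi> \<in> colorings (cube n) t \<Longrightarrow> length x = n \<Longrightarrow> spectrum (cube n) x \<phi> \<subseteq> {1..t}"
  by (auto simp: colorings_def spectrum_def)

text \<open>Colorings are constructed below as functions of a direction and a vertex. Such a function is well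
  defined on edges as soon as it does not depend on which endpoint is used.\<close>
lemma coloring_from_directions:
  assumes inv: "\<And>x i. length x = n \<Longrightarrow> i < n \<Longrightarrow> col i (flip i x) = col i x"
    and inj: "\<And>x. length x = n \<Longrightarrow> inj_on (\<lambda>i. col i x) {..<n}"
    and img: "(\<Union>x\<in>{x. length x = n}. (\<lambda>i. col i x) ` {..<n}) = {1..t}"
  obtains \<phi> where "\<phi> \<in> colorings (cube n) t"
    and "\<And>x. length x = n \<Longrightarrow> spectrum (cube n) x \<phi> = (\<lambda>i. col i x) ` {..<n}"
proof -
  define \<phi> where "\<phi> = restrict
    (\<lambda>e. THE c. \<exists>x i. length x = n \<and> i < n \<and> e = {x, flip i x} \<and> c = col i x) (edges (cube n))"
  have val: "\<phi> {x, flip i x} = col i x" if "length x = n" "i < n" for x i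
  proof -
    have "(THE c. \<exists>y i'. length y = n \<and> i' < n \<and> {x, flip i x} = {y, flip i' y} \<and> c = col i' y) = col i x"
    proof (rule the_equality)
      fix c assume "\<exists>y i'. length y = n \<and> i' < n \<and> {x, flip i x} = {y, flip i' y} \<and> c = col i' y"
      then obtain y i' where y: "length y = n" "i' < n" "{x, flip i x} = {y, flip i' y}" "c = col i' y"
        by (elim exE conjE) (rule that)
      then have "i' = i \<and> (y = x \<or> y = flip i x)"
        using that edge_eq_iff[of i x i' y] by auto
      then show "c = col i x" using y(4) inv[OF that] by auto
    next
      show "\<exists>y i'. length y = n \<and> i' < n \<and> {x, flip i x} = {y, flip i' y} \<and> col i x = col i' y"
        using that by (intro exI[of _ x] exI[of _ i]) simp
    qed
    then show ?thesis using edge_in_cube[OF that] by (simp add: \<phi>_def)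
  qed
  have rep: "\<exists>i<n. e = {x, flip i x}" if "e \<in> edges (cube n)" "x \<in> e" "length x = n" for e x
  proof -
    have "e \<in> (\<lambda>i. {x, flip i x}) ` {..<n}"
      using that edges_at_vertex[of x n] by auto
    then show ?thesis by auto
  qed
  have range: "\<phi> ` edges (cube n) = {1..t}"
  proof -
    have "\<phi> ` edges (cube n) = (\<Union>x\<in>{x. length x = n}. (\<lambda>i. col i x) ` {..<n})"
    proof (intro subset_antisym subsetI)
      fix c assume "c \<in> \<phi> ` edges (cube n)"
      then obtain x i where "length x = n" "i < n" "c = \<phi> {x, flip i x}"
        by (auto simp: edges_cube)
      then show "c \<in> (\<Union>x\<in>{x. length x = n}. (\<lambda>i. col i x) ` {..<n})"
        using val by auto
    next
      fix c assume "c \<in> (\<Union>x\<in>{x. length x = n}. (\<lambda>i. col i x) ` {..<n})"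
      then obtain x i where "length x = n" "i < n" "c = col i x" by auto
      then show "c \<in> \<phi> ` edges (cube n)"
        using val[of x i] edge_in_cube[of x n i] by (metis image_eqI)
    qed
    then show ?thesis using img by simp
  qed
  have "\<phi> e \<noteq> \<phi> e'"
    if e: "e \<in> edges (cube n)" "e' \<in> edges (cube n)" "e \<noteq> e'" "e \<inter> e' \<noteq> {}" for e e'
  proof -
    obtain x where x: "x \<in> e" "x \<in> e'" using e(4) by blast
    then have len: "length x = n" using e(1) by (auto simp: edges_cube)
    obtain i i' where "i < n" "i' < n" "e = {x, flip i x}" "e' = {x, flip i' x}"
      using rep[OF e(1) x(1) len] rep[OF e(2) x(2) len] by blast
    then show ?thesis
      using e(3) inj[OF len] len val by (auto simp: inj_on_def)
  qed
  then have "\<phi> \<in> colorings (cube n) t"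
    using range by (auto simp: colorings_def \<phi>_def)
  moreover have "spectrum (cube n) x \<phi> = (\<lambda>i. col i x) ` {..<n}" if "length x = n" for x
    using that val by (simp add: spectrum_cube)
  ultimately show ?thesis using that by blast
qed

section \<open>Linear forests in cubes\<close>

lemma sum_vertices_Suc:
  fixes f :: "bool list \<Rightarrow> nat"
  shows "(\<Sum>x\<in>{x. length x = Suc n}. f x) = (\<Sum>x\<in>{x. length x = n}. f (True # x) + f (False # x))"
proof -
  have "{x. length x = Suc n} = (#) True ` {x. length x = n} \<union> (#) False ` {x. length x = n}"
    by (auto simp: length_Suc_conv image_iff)
  moreover have "(\<Sum>x\<in>(#) True ` {x. length x = n} \<union> (#) False ` {x. length x = n}. f x)
      = (\<Sum>x\<in>(#) True ` {x. length x = n}. f x) + (\<Sum>x\<in>(#) False ` {x. length x = n}. f x)"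
    by (intro sum.union_disjoint) auto
  ultimately show ?thesis
    by (simp add: sum.reindex sum.distrib)
qed

text \<open>The vertices of the 3-subcube through \<open>x\<close> are listed instead of collected in a set, so that no
  distinctness has to be proved: the count is visibly independent of the base point and of the order
  of the directions.\<close>
definition subcube_count :: "bool list set \<Rightarrow> nat \<Rightarrow> nat \<Rightarrow> nat \<Rightarrow> bool list \<Rightarrow> nat" where
  "subcube_count I a b c x = (\<Sum>v\<leftarrow>[x, flip a x, flip b x, flip c x, flip a (flip b x),
      flip a (flip c x), flip b (flip c x), flip a (flip b (flip c x))]. of_bool (v \<in> I))"

lemma subcube_count_base:
  "subcube_count I a b c (flip a x) = subcube_count I a b c x"
  "subcube_count I a b c (flip b x) = subcube_count I a b c x"
  "subcube_count I a b c (flip c x) = subcube_count I a b c x"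
  by (simp_all add: subcube_count_def flip_commute)

lemma subcube_count_directions:
  "subcube_count I b a c x = subcube_count I a b c x"
  "subcube_count I a c b x = subcube_count I a b c x"
  by (simp_all add: subcube_count_def flip_commute)

primrec walk_verts :: "bool list \<Rightarrow> nat list \<Rightarrow> bool list set" where
  "walk_verts x [] = {x}"
| "walk_verts x (d # ds) = insert x (walk_verts (flip d x) ds)"

text \<open>The single hypothesis says that ranks are monotone along every path of length two inside \<open>I\<close>. It
  bounds the degrees in \<open>I\<close> by two and excludes cycles; both properties are inherited by subcubes.\<close>
locale ranked_linear_forest =
  fixes n :: nat and I :: "bool list set" and r :: "bool list \<Rightarrow> nat"
  assumes between: "\<lbrakk>length x = n; i < n; j < n; i \<noteq> j; x \<in> I; flip i x \<in> I; flip j x \<in> I\<rbrakk> \<Longrightarrow>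
    r (flip i x) < r x \<and> r x < r (flip j x) \<or> r (flip j x) < r x \<and> r x < r (flip i x)"
begin

text \<open>Of three neighbors two would lie on the same side of \<open>x\<close>.\<close>
lemma degree_le_2:
  assumes "length x = n" "i < n" "j < n" "k < n" "i \<noteq> j" "i \<noteq> k" "j \<noteq> k"
    and "x \<in> I" "flip i x \<in> I" "flip j x \<in> I"
  shows "flip k x \<notin> I"
  using between[of x i j] between[of x i k] between[of x j k] assms by auto

text \<open>Once a walk without immediate reversals has started upwards it can never turn down again, and
  conversely. The vertex \<open>flip d x\<close> is the one visited before \<open>x\<close>.\<close>
lemma ranks_along_walk:
  assumes "length x = n" "set (d # ds) \<subseteq> {..<n}" "successively (\<noteq>) (d # ds)"
    and "flip d x \<in> I" "walk_verts x ds \<subseteq> I"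
  shows "(r (flip d x) < r x \<longrightarrow> r x \<le> r (fold flip ds x))
    \<and> (r x < r (flip d x) \<longrightarrow> r (fold flip ds x) \<le> r x)"
  using assms
proof (induction ds arbitrary: x d)
  case (Cons d' ds)
  have "x \<in> I" "flip d' x \<in> I" "d \<noteq> d'"
    using Cons.prems by (cases ds; auto)+
  then have "r (flip d x) < r x \<and> r x < r (flip d' x) \<or> r (flip d' x) < r x \<and> r x < r (flip d x)"
    using between[of x d d'] Cons.prems by auto
  moreover have "(r (flip d' (flip d' x)) < r (flip d' x) \<longrightarrow> r (flip d' x) \<le> r (fold flip ds (flip d' x)))
    \<and> (r (flip d' x) < r (flip d' (flip d' x)) \<longrightarrow> r (fold flip ds (flip d' x)) \<le> r (flip d' x))"
    using Cons.prems \<open>x \<in> I\<close> by (intro Cons.IH) auto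
  ultimately show ?case by auto
qed simp

text \<open>The walk would have to return to the rank of its first vertex after leaving it monotonically.\<close>
lemma no_closed_walk:
  assumes "length x = n" "set (d # ds) \<subseteq> {..<n}" "successively (\<noteq>) (d # ds)"
    and "ds \<noteq> []" "fold flip (d # ds) x = x"
  shows "\<not> walk_verts x (d # ds) \<subseteq> I"
proof
  assume I: "walk_verts x (d # ds) \<subseteq> I"
  let ?y = "flip d x"
  obtain d' ds' where ds: "ds = d' # ds'" using assms(4) by (cases ds) auto
  have "?y \<in> I" "flip d' ?y \<in> I" using I by (cases ds'; auto simp: ds)+
  then have "r x \<noteq> r ?y"
    using between[of ?y d d'] I assms(1-3) by (auto simp: ds)
  moreover have "(r (flip d ?y) < r ?y \<longrightarrow> r ?y \<le> r (fold flip ds ?y))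
    \<and> (r ?y < r (flip d ?y) \<longrightarrow> r (fold flip ds ?y) \<le> r ?y)"
    using assms(1-3) I by (intro ranks_along_walk) auto
  ultimately show False using assms(5) by auto
qed

lemma no_4_cycle:
  assumes "length x = n" "i < n" "j < n" "i \<noteq> j" "x \<in> I" "flip i x \<in> I" "flip j x \<in> I"
  shows "flip i (flip j x) \<notin> I"
  using no_closed_walk[of x i "[j, i, j]"] assms by (auto simp: flip_commute)

text \<open>The hexagon consists of the vertices of a 3-cube other than \<open>x\<close> and its antipode.\<close>
lemma no_6_cycle:
  assumes "length x = n" "i < n" "j < n" "k < n" "i \<noteq> j" "i \<noteq> k" "j \<noteq> k"
    and "flip i x \<in> I" "flip j x \<in> I" "flip k x \<in> I"
    and "flip i (flip j x) \<in> I" "flip i (flip k x) \<in> I"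
  shows "flip j (flip k x) \<notin> I"
  using no_closed_walk[of "flip i x" j "[i, k, j, i, k]"] assms by (auto simp: flip_commute)

text \<open>This octagon of a 4-cube is a path with five vertices in one 3-cube closed up by a path with three
  vertices in the opposite 3-cube.\<close>
lemma no_8_cycle:
  assumes "length x = n" "i < n" "j < n" "k < n" "l < n" "distinct [i, j, k, l]"
    and "flip i (flip j x) \<in> I" "flip i x \<in> I" "flip i (flip k x) \<in> I" "flip k x \<in> I" "flip j (flip k x) \<in> I"
    and "flip l (flip j (flip k x)) \<in> I" "flip l (flip i (flip j (flip k x))) \<in> I"
  shows "flip l (flip i (flip j x)) \<notin> I"
  using no_closed_walk[of "flip i (flip j x)" j "[k, i, j, l, i, k, l]"] assms
  by (auto simp: flip_commute)

text \<open>The three given vertices have the parity of \<open>z\<close>. The antipode of \<open>z\<close> is adjacent to all of them, so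
  it is excluded by its degree. If \<open>z\<close> were in \<open>I\<close>, each of its neighbors would have degree three and
  only four vertices would be left. So at least two neighbors of \<open>z\<close> belong to \<open>I\<close>, and not all
  three, since that would be a hexagon. The five vertices form a path.\<close>
lemma dense_3_subcube:
  assumes "length z = n" "a < n" "b < n" "c < n" "a \<noteq> b" "a \<noteq> c" "b \<noteq> c"
    and "flip a (flip b z) \<in> I" "flip a (flip c z) \<in> I" "flip b (flip c z) \<in> I"
    and "subcube_count I a b c z \<ge> 5"
  shows "subcube_count I a b c z = 5 \<and> (flip a z \<in> I \<and> flip b z \<in> I
    \<or> flip a z \<in> I \<and> flip c z \<in> I \<or> flip b z \<in> I \<and> flip c z \<in> I)"
proof -
  have "flip a (flip b (flip c z)) \<notin> I"
    using degree_le_2[of "flip a (flip b (flip c z))" a b c] assms by (auto simp: flip_commute)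
  moreover have "z \<in> I \<Longrightarrow> flip a z \<notin> I" "z \<in> I \<Longrightarrow> flip b z \<notin> I" "z \<in> I \<Longrightarrow> flip c z \<notin> I"
    using degree_le_2[of "flip a z" a b c] degree_le_2[of "flip b z" b a c] degree_le_2[of "flip c z" c a b] assms
    by (auto simp: flip_commute)
  moreover have "\<not> (flip a z \<in> I \<and> flip b z \<in> I \<and> flip c z \<in> I)"
    using no_6_cycle[of z a b c] assms by auto
  ultimately show ?thesis using assms(8-)
    unfolding subcube_count_def
    by (cases "z \<in> I"; cases "flip a z \<in> I"; cases "flip b z \<in> I"; cases "flip c z \<in> I"; simp)
qed

text \<open>The path is \<open>ab - a - ac - c - bc\<close>, where a word stands for the flips applied to \<open>z\<close>. Its three
  inner vertices have no further neighbor in \<open>I\<close>, which leaves \<open>1, b, ab, bc, abc\<close> in the opposite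
  3-cube. Four of these five cannot occur together: without \<open>b\<close> they would close the path to an
  octagon, and in the other cases some vertex would get a third neighbor.\<close>
lemma opposite_of_path:
  assumes "length z = n" "a < n" "b < n" "c < n" "l < n" "distinct [a, b, c, l]"
    and "flip a (flip b z) \<in> I" "flip a z \<in> I" "flip a (flip c z) \<in> I" "flip c z \<in> I" "flip b (flip c z) \<in> I"
  shows "subcube_count I a b c (flip l z) \<le> 3"
proof -
  have "flip a (flip l z) \<notin> I" "flip c (flip l z) \<notin> I" "flip a (flip c (flip l z)) \<notin> I"
    using degree_le_2[of "flip a z" b c l] degree_le_2[of "flip c z" a b l] degree_le_2[of "flip a (flip c z)" a c l] assms
    by (auto simp: flip_commute)
  moreover have "\<not> (flip l z \<in> I \<and> flip b (flip l z) \<in> I \<and> flip a (flip b (flip l z)) \<in> I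
      \<and> flip b (flip c (flip l z)) \<in> I)"
    using degree_le_2[of "flip b (flip l z)" a b c] assms
    by (auto simp: flip_commute)
  moreover have "\<not> (flip a (flip b (flip l z)) \<in> I \<and> flip b (flip c (flip l z)) \<in> I \<and> flip a (flip b (flip c (flip l z))) \<in> I)"
    using no_8_cycle[of z a b c l] assms
    by (auto simp: flip_commute)
  moreover have "\<not> (flip b (flip l z) \<in> I \<and> flip b (flip c (flip l z)) \<in> I \<and> flip a (flip b (flip c (flip l z))) \<in> I)"
    using degree_le_2[of "flip b (flip c (flip l z))" a c l] assms
    by (auto simp: flip_commute)
  moreover have "\<not> (flip b (flip l z) \<in> I \<and> flip a (flip b (flip l z)) \<in> I \<and> flip a (flip b (flip c (flip l z))) \<in> I)"
    using degree_le_2[of "flip a (flip b (flip l z))" a c l] assms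
    by (auto simp: flip_commute)
  ultimately show ?thesis
    unfolding subcube_count_def by (auto simp: of_bool_def)
qed

text \<open>Five vertices of a 3-cube include three of the same parity; these are the vertices at distance two
  from the fourth vertex \<open>z\<close> of that parity, so the two preceding lemmas apply at \<open>z\<close>.\<close>
lemma subcube_3_bound:
  assumes len: "length x = n" and dirs: "a < n" "b < n" "c < n" "a \<noteq> b" "a \<noteq> c" "b \<noteq> c"
    and dense: "subcube_count I a b c x \<ge> 5"
  shows "subcube_count I a b c x = 5 \<and> (\<forall>l<n. l \<notin> {a, b, c} \<longrightarrow> subcube_count I a b c (flip l x) \<le> 3)"
proof -
  define good where "good z \<longleftrightarrow> flip a (flip b z) \<in> I \<and> flip a (flip c z) \<in> I \<and> flip b (flip c z) \<in> I" for z
  \<comment> \<open>the claim may be proved from any base point \<open>z\<close> of the same 3-subcube\<close>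
  have core: ?thesis if good: "good z" and z: "length z = n"
    and same: "\<And>l. subcube_count I a b c (flip l z) = subcube_count I a b c (flip l x)"
       "subcube_count I a b c z = subcube_count I a b c x" for z
  proof -
    have *: "flip a (flip b z) \<in> I" "flip a (flip c z) \<in> I" "flip b (flip c z) \<in> I"
      using good by (auto simp: good_def)
    from dense_3_subcube[OF z dirs * ] dense same
    have "subcube_count I a b c z = 5"
      and two: "flip a z \<in> I \<and> flip b z \<in> I \<or> flip a z \<in> I \<and> flip c z \<in> I \<or> flip b z \<in> I \<and> flip c z \<in> I"
      by auto
    moreover have "subcube_count I a b c (flip l z) \<le> 3" if l: "l < n" "l \<notin> {a, b, c}" for l
      using two
    proof (elim disjE conjE)
      assume "flip a z \<in> I" "flip b z \<in> I"
      with opposite_of_path[of z a c b l] show ?thesis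
        using z dirs l * by (auto simp: subcube_count_directions flip_commute)
    next
      assume "flip a z \<in> I" "flip c z \<in> I"
      with opposite_of_path[of z a b c l] show ?thesis
        using z dirs l * by (auto simp: subcube_count_directions flip_commute)
    next
      assume "flip b z \<in> I" "flip c z \<in> I"
      with opposite_of_path[of z b a c l] show ?thesis
        using z dirs l * by (auto simp: subcube_count_directions flip_commute)
    qed
    ultimately show ?thesis using same by simp
  qed
  have shift: "subcube_count I a b c (flip l (flip d y)) = subcube_count I a b c (flip l y)"
    if "d \<in> {a, b, c}" for l d y
    using that subcube_count_base[of I a b c "flip l y"] flip_commute[of l d y] by auto
  have "good x \<or> good (flip a x) \<or> good (flip b x) \<or> good (flip c x) \<or> good (flip a (flip b x))
    \<or> good (flip a (flip c x)) \<or> good (flip b (flip c x)) \<or> good (flip a (flip b (flip c x)))"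
    using dense unfolding subcube_count_def good_def
    by (simp add: flip_commute of_bool_def split: if_splits)
  then obtain z where z: "good z" "z \<in> {x, flip a x, flip b x, flip c x, flip a (flip b x),
      flip a (flip c x), flip b (flip c x), flip a (flip b (flip c x))}"
    by blast
  show ?thesis
    by (rule core[OF z(1)]) (use z(2) in \<open>auto simp: len subcube_count_base shift\<close>)
qed

lemma card_eq_sum: "card {x. length x = n \<and> x \<in> I} = (\<Sum>x\<in>{x. length x = n}. of_bool (x \<in> I))"
  by (simp add: sum_of_bool_eq Int_def)

lemma card_square:
  assumes "n = 2"
  shows "card {x. length x = n \<and> x \<in> I} \<le> 3"
proof -
  have "\<not> ([False, False] \<in> I \<and> [True, False] \<in> I \<and> [False, True] \<in> I \<and> [True, True] \<in> I)"
    using no_4_cycle[of "[False, False]" 0 1] assms by auto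
  then show ?thesis
    unfolding card_eq_sum using assms by (auto simp: numeral_2_eq_2 sum_vertices_Suc of_bool_def)
qed

lemma card_3_cube:
  assumes "n = 3"
  shows "card {x. length x = n \<and> x \<in> I} \<le> 5"
proof -
  have "subcube_count I 0 1 2 [False, False, False] \<le> 5"
    using subcube_3_bound[of "[False, False, False]" 0 1 2] assms by force
  then show ?thesis
    unfolding card_eq_sum using assms
    by (simp add: numeral_3_eq_3 numeral_2_eq_2 sum_vertices_Suc subcube_count_def)
qed

text \<open>If neither 3-cube has five vertices of \<open>I\<close> the bound is \<open>4 + 4\<close>, otherwise it is \<open>5 + 3\<close>.\<close>
lemma opposite_subcubes_bound:
  assumes "length x = n" "n \<ge> 4"
  shows "subcube_count I 0 1 2 x + subcube_count I 0 1 2 (flip 3 x) \<le> 8"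
proof -
  have dense: "subcube_count I 0 1 2 y = 5 \<and> subcube_count I 0 1 2 (flip 3 y) \<le> 3"
    if "length y = n" "subcube_count I 0 1 2 y \<ge> 5" for y
    using subcube_3_bound[of y 0 1 2] that assms(2) by simp
  show ?thesis
    using dense[of x] dense[of "flip 3 x"] assms(1)
    by (cases "subcube_count I 0 1 2 x \<ge> 5"; cases "subcube_count I 0 1 2 (flip 3 x) \<ge> 5") simp_all
qed

text \<open>Fixing all but the first four coordinates splits the cube into 4-cubes.\<close>
lemma card_large_cube:
  assumes "n \<ge> 4"
  shows "card {x. length x = n \<and> x \<in> I} \<le> 2 ^ (n - 1)"
proof -
  obtain m where m: "n = m + 4" using assms by (metis le_add_diff_inverse2)
  let ?f = "\<lambda>y. subcube_count I 0 1 2 (False # False # False # False # y)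
    + subcube_count I 0 1 2 (flip 3 (False # False # False # False # y))"
  have "card {x. length x = n \<and> x \<in> I} = (\<Sum>y\<in>{y. length y = m}. ?f y)"
    unfolding card_eq_sum
    by (simp add: m sum_vertices_Suc numeral_eq_Suc subcube_count_def) (simp add: add_ac)
  also have "\<dots> \<le> (\<Sum>y\<in>{y :: bool list. length y = m}. 8)"
    using opposite_subcubes_bound by (intro sum_mono) (simp add: m)
  also have "\<dots> = 2 ^ (n - 1)"
    by (simp add: m card_vertices power_add)
  finally show ?thesis .
qed

end

section \<open>Rainbow colorings\<close>

lemma interval_count_le: "interval_count (cube n) \<phi> \<le> 2 ^ n"
proof -
  have "interval_count (cube n) \<phi> \<le> card {x :: bool list. length x = n}"
    unfolding interval_count_def by (intro card_mono) auto
  then show ?thesis by (simp add: card_vertices)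
qed

lemma interval_spectrum:
  assumes \<phi>: "\<phi> \<in> colorings (cube n) t" and x: "length x = n" and n: "n \<ge> 1"
    and "is_int_interval (spectrum (cube n) x \<phi>)"
  shows "spectrum (cube n) x \<phi> = {Min (spectrum (cube n) x \<phi>)..<Min (spectrum (cube n) x \<phi>) + n}"
proof -
  obtain a b where ab: "a \<le> b" "spectrum (cube n) x \<phi> = {a..b}"
    using assms(4) by (auto simp: is_int_interval_def)
  then have "Suc b = a + n" using card_spectrum[OF \<phi> x] by simp
  moreover have "Min {a..b} = a" using ab(1) by (intro Min_eqI) auto
  ultimately show ?thesis using ab by (metis atLeastLessThanSuc_atLeastAtMost)
qed

text \<open>Ranking interval vertices by their least color, the color of an edge between two of them is the
  largest color at the lower end and the smallest color at the upper end. Two neighbors on the same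
  side would therefore be joined to \<open>x\<close> by edges of the same color. With as many colors as edges,
  all edges have different colors.\<close>
lemma rainbow_ranked_linear_forest:
  assumes \<phi>: "\<phi> \<in> colorings (cube n) (card (edges (cube n)))"
  shows "ranked_linear_forest n {x. length x = n \<and> is_int_interval (spectrum (cube n) x \<phi>)}
    (\<lambda>x. Min (spectrum (cube n) x \<phi>))"
proof
  define I where "I = {x. length x = n \<and> is_int_interval (spectrum (cube n) x \<phi>)}"
  define r where "r x = Min (spectrum (cube n) x \<phi>)" for x
  have "\<phi> ` edges (cube n) = {1..card (edges (cube n))}"
    using \<phi> by (simp add: colorings_def)
  then have inj: "inj_on \<phi> (edges (cube n))"
    by (intro eq_card_imp_inj_on) simp_all
  have step: "r x < r (flip i x) \<and> \<phi> {x, flip i x} = r x + n - 1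
      \<or> r (flip i x) < r x \<and> \<phi> {x, flip i x} = r x"
    if x: "x \<in> I" "flip i x \<in> I" and i: "i < n" and n: "n \<ge> 2" for x i
  proof -
    let ?y = "flip i x"
    have len: "length x = n" using x by (simp add: I_def)
    have spec: "spectrum (cube n) v \<phi> = {r v..<r v + n}" if "v \<in> I" for v
      using interval_spectrum[OF \<phi>, of v] that n by (simp add: I_def r_def)
    have common: "{r x..<r x + n} \<inter> {r ?y..<r ?y + n} = {\<phi> {x, ?y}}"
    proof (intro subset_antisym subsetI)
      fix c assume "c \<in> {r x..<r x + n} \<inter> {r ?y..<r ?y + n}"
      then have "c \<in> spectrum (cube n) x \<phi>" "c \<in> spectrum (cube n) ?y \<phi>"
        using spec x by auto
      then obtain e e' where e: "e \<in> edges (cube n)" "x \<in> e" "c = \<phi> e"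
          "e' \<in> edges (cube n)" "?y \<in> e'" "c = \<phi> e'"
        by (auto simp: spectrum_def)
      then have "e' = e" using inj by (metis inj_onD)
      moreover obtain p where "e = {x, flip p x}"
        using e(1,2) edges_at_vertex[OF len] by blast
      ultimately have "e = {x, ?y}" using e(5) flip_neq[of i x] i len by auto
      then show "c \<in> {\<phi> {x, ?y}}" using e by simp
    next
      fix c assume "c \<in> {\<phi> {x, ?y}}"
      then have "c \<in> spectrum (cube n) x \<phi>" "c \<in> spectrum (cube n) ?y \<phi>"
        using edge_in_cube[OF len i] by (auto simp: spectrum_def)
      then show "c \<in> {r x..<r x + n} \<inter> {r ?y..<r ?y + n}"
        using spec x by auto
    qed
    let ?c = "\<phi> {x, ?y}"
    have c: "r x \<le> ?c" "?c < r x + n" "r ?y \<le> ?c" "?c < r ?y + n"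
      using equalityD2[OF common] by simp_all
    have only: "d = ?c" if "r x \<le> d" "d < r x + n" "r ?y \<le> d" "d < r ?y + n" for d
    proof -
      have "d \<in> {r x..<r x + n} \<inter> {r ?y..<r ?y + n}" using that by simp
      then show ?thesis unfolding common by simp
    qed
    consider "r x < r ?y" | "r ?y < r x" | "r x = r ?y" by linarith
    then show ?thesis
    proof cases
      case 1
      then show ?thesis using only[of "r x + n - 1"] c n by auto
    next
      case 2
      then show ?thesis using only[of "r x"] c n by auto
    next
      case 3
      then show ?thesis using only[of "r x"] only[of "r x + 1"] n by auto
    qed
  qed
  fix x i j
  assume *: "length x = n" "i < n" "j < n" "i \<noteq> j" "x \<in> {x. length x = n \<and> is_int_interval (spectrum (cube n) x \<phi>)}"
    "flip i x \<in> {x. length x = n \<and> is_int_interval (spectrum (cube n) x \<phi>)}"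
    "flip j x \<in> {x. length x = n \<and> is_int_interval (spectrum (cube n) x \<phi>)}"
  moreover have "\<phi> {x, flip i x} \<noteq> \<phi> {x, flip j x}"
    using coloring_inj_at_vertex[OF \<phi> *(1)] *(2-4) by (auto simp: inj_on_def)
  ultimately show "Min (spectrum (cube n) (flip i x) \<phi>) < Min (spectrum (cube n) x \<phi>)
      \<and> Min (spectrum (cube n) x \<phi>) < Min (spectrum (cube n) (flip j x) \<phi>)
    \<or> Min (spectrum (cube n) (flip j x) \<phi>) < Min (spectrum (cube n) x \<phi>)
      \<and> Min (spectrum (cube n) x \<phi>) < Min (spectrum (cube n) (flip i x) \<phi>)"
    using step[of x i] step[of x j] unfolding I_def[symmetric] r_def[symmetric] by auto
qed

lemma rainbow_interval_count_le:
  assumes "\<phi> \<in> colorings (cube n) (card (edges (cube n)))" and "n \<ge> 1"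
  shows "interval_count (cube n) \<phi> \<le> 2 ^ (n - 1) + (if n \<le> 3 then 1 else 0)"
proof -
  interpret ranked_linear_forest n "{x. length x = n \<and> is_int_interval (spectrum (cube n) x \<phi>)}"
    "\<lambda>x. Min (spectrum (cube n) x \<phi>)"
    by (rule rainbow_ranked_linear_forest[OF assms(1)])
  have count: "interval_count (cube n) \<phi> = card {x. length x = n \<and> x \<in> {x. length x = n \<and> is_int_interval (spectrum (cube n) x \<phi>)}}"
    by (simp add: interval_count_def)
  consider "n = 1" | "n = 2" | "n = 3" | "n \<ge> 4" using assms(2) by linarith
  then show ?thesis
  proof cases
    case 1
    then show ?thesis using interval_count_le[of n \<phi>] by simp
  qed (use card_square card_3_cube card_large_cube count in auto)
qed

section \<open>Reducing the number of colors\<close>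

text \<open>Colors above \<open>t\<close> are moved to the representative of their residue modulo \<open>n\<close> in \<open>{t + 1 - n..t}\<close>.\<close>
definition fold_color :: "nat \<Rightarrow> nat \<Rightarrow> nat \<Rightarrow> nat" where
  "fold_color n t c = (if c \<le> t then c else t + 1 - n + (c - (t + 1 - n)) mod n)"

lemma fold_color_mod:
  assumes "n \<le> t" shows "fold_color n t c mod n = c mod n"
proof (cases "c \<le> t")
  case False
  then have "fold_color n t c mod n = (t + 1 - n + (c - (t + 1 - n))) mod n"
    by (simp add: fold_color_def mod_add_right_eq)
  then show ?thesis using False by simp
qed (simp add: fold_color_def)

lemma fold_color_range:
  assumes "1 \<le> n" "n \<le> t" "c > t - n"
  shows "fold_color n t c \<in> {t + 1 - n..t}"
proof -
  have "(c - (t + 1 - n)) mod n < n" using assms by simp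
  then have "t + 1 - n + (c - (t + 1 - n)) mod n \<le> t" using assms by linarith
  then show ?thesis using assms by (auto simp: fold_color_def)
qed

lemma fold_color_image:
  assumes "1 \<le> n" "n \<le> t" "t \<le> T"
  shows "fold_color n t ` {1..T} = {1..t}"
proof (intro subset_antisym subsetI)
  fix d assume "d \<in> fold_color n t ` {1..T}"
  then obtain c where "c \<in> {1..T}" "d = fold_color n t c" by blast
  then show "d \<in> {1..t}"
    using fold_color_range[OF assms(1,2), of c] assms by (cases "c \<le> t") (auto simp: fold_color_def)
next
  fix d assume "d \<in> {1..t}"
  then show "d \<in> fold_color n t ` {1..T}"
    using assms by (intro image_eqI[of _ _ d]) (auto simp: fold_color_def)
qed

text \<open>Either nothing moves, or the whole interval ends up in the window \<open>{t + 1 - n..t}\<close>, which it fills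
  because its \<open>n\<close> residues are distinct.\<close>
lemma fold_color_interval:
  assumes n: "1 \<le> n" "n \<le> t"
    and S: "is_int_interval S" "inj_on (\<lambda>c. c mod n) S" "card S = n"
  shows "is_int_interval (fold_color n t ` S)"
proof -
  obtain a b where ab: "a \<le> b" "S = {a..b}" using S(1) by (auto simp: is_int_interval_def)
  have b: "Suc b = a + n" using ab S(3) by simp
  show ?thesis
  proof (cases "b \<le> t")
    case True
    then have "fold_color n t ` S = S" using ab by (auto simp: fold_color_def)
    then show ?thesis using S(1) by simp
  next
    case False
    have "inj_on (fold_color n t) S"
      using S(2) fold_color_mod[OF n(2)] unfolding inj_on_def by metis
    moreover have "fold_color n t ` S \<subseteq> {t + 1 - n..t}"
      using fold_color_range[OF n] ab b False n by fastforce
    ultimately have "fold_color n t ` S = {t + 1 - n..t}"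
      using S(3) n by (intro card_subset_eq) (auto simp: card_image)
    moreover have "t + 1 - n \<le> t" using n by simp
    ultimately show ?thesis unfolding is_int_interval_def by blast
  qed
qed

text \<open>An edge of direction \<open>i\<close> at level \<open>g i x\<close> gets a color of the block of \<open>n\<close> colors belonging to that
  level, with a residue that depends only on \<open>i\<close>. Within a block the colors decrease with the
  direction; in the Gray code construction this makes consecutive spectra overlap.\<close>
definition level_color :: "nat \<Rightarrow> (nat \<Rightarrow> bool list \<Rightarrow> nat) \<Rightarrow> nat \<Rightarrow> bool list \<Rightarrow> nat" where
  "level_color n g i x = n * g i x + (n - i)"

lemma level_color_mod_inj:
  "inj_on (\<lambda>i. level_color n g i x mod n) {..<n}"
proof (rule inj_onI)
  fix i j assume *: "i \<in> {..<n}" "j \<in> {..<n}" "level_color n g i x mod n = level_color n g j x mod n"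
  then have "(n - i) mod n = (n - j) mod n" by (simp only: level_color_def mod_mult_self4)
  then show "i = j" using * by (cases "i = 0"; cases "j = 0") auto
qed

text \<open>If the levels of each direction run through all of \<open>{..<2 ^ (n - 1)}\<close>, the level coloring uses every
  color up to the number of edges. Folding it down to \<open>t\<close> colors loses no interval vertex.\<close>
lemma level_coloring:
  assumes n: "1 \<le> n" "n \<le> t" "t \<le> n * 2 ^ (n - 1)"
    and inv: "\<And>x i. length x = n \<Longrightarrow> i < n \<Longrightarrow> g i (flip i x) = g i x"
    and surj: "\<And>i. i < n \<Longrightarrow> g i ` {x. length x = n} = {..<2 ^ (n - 1)}"
  obtains \<phi> where "\<phi> \<in> colorings (cube n) t"
    and "interval_count (cube n) \<phi> \<ge>
      card {x. length x = n \<and> is_int_interval ((\<lambda>i. level_color n g i x) ` {..<n})}"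
proof -
  let ?col = "level_color n g"
  have all: "(\<Union>x\<in>{x. length x = n}. (\<lambda>i. ?col i x) ` {..<n}) = {1..n * 2 ^ (n - 1)}"
  proof (intro subset_antisym subsetI)
    fix c assume "c \<in> (\<Union>x\<in>{x. length x = n}. (\<lambda>i. ?col i x) ` {..<n})"
    then obtain x i where *: "length x = n" "i < n" "c = n * g i x + (n - i)"
      by (auto simp: level_color_def)
    then have "g i x < 2 ^ (n - 1)" using surj[of i] by blast
    then have "n * (g i x + 1) \<le> n * 2 ^ (n - 1)" by (intro mult_le_mono2) simp
    then show "c \<in> {1..n * 2 ^ (n - 1)}" using * by auto
  next
    fix c :: nat assume c: "c \<in> {1..n * 2 ^ (n - 1)}"
    define q s where "q = (c - 1) div n" and "s = (c - 1) mod n"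
    have "c - 1 < 2 ^ (n - 1) * n" using c by (auto simp: mult.commute)
    then have q: "q < 2 ^ (n - 1)" unfolding q_def by (rule less_mult_imp_div_less)
    have s: "s < n" using n by (simp add: s_def)
    have "c - 1 = n * q + s" by (simp add: q_def s_def)
    then have cs: "c = n * q + s + 1" using c by (cases c) auto
    define i where "i = n - 1 - s"
    have i: "i < n" "n - i = s + 1" using s by (auto simp: i_def)
    obtain x where x: "length x = n" "g i x = q"
    proof -
      have "q \<in> g i ` {x. length x = n}" unfolding surj[OF i(1)] using q by simp
      then show ?thesis using that by auto
    qed
    have "c = ?col i x" using cs i x by (simp add: level_color_def)
    then show "c \<in> (\<Union>x\<in>{x. length x = n}. (\<lambda>i. ?col i x) ` {..<n})"
      using x i by blast
  qed
  let ?folded = "\<lambda>i x. fold_color n t (?col i x)"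
  have "(\<Union>x\<in>{x. length x = n}. (\<lambda>i. ?folded i x) ` {..<n}) = fold_color n t ` (\<Union>x\<in>{x. length x = n}. (\<lambda>i. ?col i x) ` {..<n})"
    by (simp add: image_UN image_image)
  then have img: "(\<Union>x\<in>{x. length x = n}. (\<lambda>i. ?folded i x) ` {..<n}) = {1..t}"
    using fold_color_image[OF n] all by simp
  have inj: "inj_on (\<lambda>i. ?folded i x) {..<n}" for x
    using level_color_mod_inj[of n g x] fold_color_mod[OF n(2)] unfolding inj_on_def by metis
  obtain \<phi> where \<phi>: "\<phi> \<in> colorings (cube n) t"
    and spec: "\<And>x. length x = n \<Longrightarrow> spectrum (cube n) x \<phi> = (\<lambda>i. ?folded i x) ` {..<n}"
    using coloring_from_directions[of n ?folded t] inj img inv by (auto simp: level_color_def)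
  have "is_int_interval (spectrum (cube n) x \<phi>)"
    if "length x = n" "is_int_interval ((\<lambda>i. ?col i x) ` {..<n})" for x
  proof -
    have "inj_on (\<lambda>i. ?col i x) {..<n}"
      using level_color_mod_inj[of n g x] unfolding inj_on_def by metis
    then have "card ((\<lambda>i. ?col i x) ` {..<n}) = n" by (simp add: card_image)
    moreover have "inj_on (\<lambda>c. c mod n) ((\<lambda>i. ?col i x) ` {..<n})"
      using level_color_mod_inj[of n g x] by (intro inj_on_imageI) (simp add: comp_def)
    ultimately have "is_int_interval (fold_color n t ` (\<lambda>i. ?col i x) ` {..<n})"
      using that by (intro fold_color_interval[OF n(1,2)])
    then show ?thesis using that by (simp add: spec image_image)
  qed
  then have "card {x. length x = n \<and> is_int_interval ((\<lambda>i. ?col i x) ` {..<n})} \<le> interval_count (cube n) \<phi>"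
    unfolding interval_count_def by (intro card_mono) auto
  then show ?thesis using \<phi> that by blast
qed

section \<open>Colorings with many interval vertices\<close>

text \<open>The level of an edge is the number, in an arbitrary enumeration, of its endpoint of even weight.
  Each vertex of even weight then sees one whole block.\<close>
lemma many_intervals_coloring_even:
  assumes n: "1 \<le> n" "n \<le> t" "t \<le> n * 2 ^ (n - 1)"
  obtains \<phi> where "\<phi> \<in> colorings (cube n) t" "interval_count (cube n) \<phi> \<ge> 2 ^ (n - 1)"
proof -
  let ?E = "{x. length x = n \<and> \<not> odd_weight x}"
  have "finite ?E" by simp
  then obtain h where "bij_betw h ?E {0..<card ?E}"
    using ex_bij_betw_finite_nat by blast
  then have h: "h ` ?E = {..<2 ^ (n - 1)}"
    using card_even_vertices[OF n(1)] by (simp add: bij_betw_def atLeast0LessThan)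
  define g where "g i x = h (if odd_weight x then flip i x else x)" for i x
  have inv: "g i (flip i x) = g i x" if "length x = n" "i < n" for x i
    using that by (simp add: g_def odd_weight_flip)
  have surj: "g i ` {x. length x = n} = {..<2 ^ (n - 1)}" if i: "i < n" for i
  proof -
    have "(\<lambda>x. if odd_weight x then flip i x else x) ` {x. length x = n} = ?E"
    proof (intro subset_antisym subsetI)
      fix x assume "x \<in> ?E"
      then show "x \<in> (\<lambda>x. if odd_weight x then flip i x else x) ` {x. length x = n}"
        by (intro image_eqI[of _ _ x]) auto
    qed (use i odd_weight_flip in auto)
    moreover have "g i ` {x. length x = n}
        = h ` (\<lambda>x. if odd_weight x then flip i x else x) ` {x. length x = n}"
      by (simp only: g_def[abs_def] image_image)
    ultimately show ?thesis using h by simp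
  qed
  have "is_int_interval ((\<lambda>i. level_color n g i x) ` {..<n})" if "x \<in> ?E" for x
  proof -
    have "(\<lambda>i. level_color n g i x) ` {..<n} = {n * h x + 1..n * h x + n}"
    proof (intro subset_antisym subsetI)
      fix c assume c: "c \<in> {n * h x + 1..n * h x + n}"
      then have "c = level_color n g (n * h x + n - c) x" "n * h x + n - c < n"
        using that by (auto simp: level_color_def g_def)
      then show "c \<in> (\<lambda>i. level_color n g i x) ` {..<n}" by blast
    qed (use that in \<open>auto simp: level_color_def g_def\<close>)
    then show ?thesis using n by (auto simp: is_int_interval_def)
  qed
  then have "card ?E \<le> card {x. length x = n \<and> is_int_interval ((\<lambda>i. level_color n g i x) ` {..<n})}"
    by (intro card_mono) auto
  moreover obtain \<phi> where "\<phi> \<in> colorings (cube n) t" and "interval_count (cube n) \<phi> \<ge>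
      card {x. length x = n \<and> is_int_interval ((\<lambda>i. level_color n g i x) ` {..<n})}"
    using level_coloring[OF n inv surj] by blast
  ultimately show ?thesis
    using that card_even_vertices[OF n(1)] by simp
qed

text \<open>This is the position of a word in the reflected binary Gray code, lowest bit first.\<close>
primrec gray_rank :: "bool list \<Rightarrow> nat" where
  "gray_rank [] = 0"
| "gray_rank (b # x) = 2 * gray_rank x + of_bool (b \<noteq> odd (gray_rank x))"

lemma gray_rank_image: "gray_rank ` {x. length x = m} = {..<2 ^ m}"
proof (induction m)
  case (Suc m)
  show ?case
  proof (intro subset_antisym subsetI)
    fix v assume "v \<in> gray_rank ` {x. length x = Suc m}"
    then obtain b y where v: "v = gray_rank (b # y)" "length y = m"
      by (auto simp: length_Suc_conv)
    then have "gray_rank y < 2 ^ m" using Suc by blast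
    then show "v \<in> {..<2 ^ Suc m}" using v by (auto simp: of_bool_def)
  next
    fix v :: nat assume "v \<in> {..<2 ^ Suc m}"
    then have "v div 2 < 2 ^ m" by auto
    then obtain y where y: "length y = m" "gray_rank y = v div 2"
      using Suc by (metis (mono_tags, lifting) imageE lessThan_iff mem_Collect_eq)
    have "v = gray_rank ((odd v \<noteq> odd (v div 2)) # y)"
      using y by (simp add: of_bool_def) presburger
    then show "v \<in> gray_rank ` {x. length x = Suc m}"
      using y by (intro image_eqI[of _ _ "(odd v \<noteq> odd (v div 2)) # y"]) auto
  qed
qed (simp add: lessThan_Suc)

definition remove_nth :: "nat \<Rightarrow> bool list \<Rightarrow> bool list" where
  "remove_nth i x = take i x @ drop (Suc i) x"

lemma remove_nth_flip [simp]: "remove_nth i (flip i x) = remove_nth i x"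
  by (simp add: remove_nth_def flip_def)

lemma remove_nth_image:
  assumes "i < n"
  shows "remove_nth i ` {x. length x = n} = {y. length y = n - 1}"
proof (intro subset_antisym subsetI)
  fix y :: "bool list" assume "y \<in> {y. length y = n - 1}"
  then have "y = remove_nth i (take i y @ True # drop i y)" "length (take i y @ True # drop i y) = n"
    using assms by (auto simp: remove_nth_def)
  then show "y \<in> remove_nth i ` {x. length x = n}" by blast
qed (use assms in \<open>auto simp: remove_nth_def\<close>)

text \<open>The level of an edge is the Gray rank of the remaining coordinates. Along the path of
  \<open>2 ^ (n - 1) + 1\<close> vertices listed below, each spectrum is an interval; for \<open>n \<ge> 2\<close> it begins with
  the color at which the previous one ended, the color of the edge between the two vertices.\<close>
lemma many_intervals_coloring_small:
  assumes n: "1 \<le> n" "n \<le> 3" "n \<le> t" "t \<le> n * 2 ^ (n - 1)"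
  obtains \<phi> where "\<phi> \<in> colorings (cube n) t" "interval_count (cube n) \<phi> \<ge> 2 ^ (n - 1) + 1"
proof -
  let ?g = "\<lambda>i x. gray_rank (remove_nth i x)"
  let ?V = "{x. length x = n \<and> is_int_interval ((\<lambda>i. level_color n ?g i x) ` {..<n})}"
  have surj: "?g i ` {x. length x = n} = {..<2 ^ (n - 1)}" if "i < n" for i
  proof -
    have "?g i ` {x. length x = n} = gray_rank ` remove_nth i ` {x. length x = n}"
      by (simp only: image_image)
    then show ?thesis by (simp only: remove_nth_image[OF that] gray_rank_image)
  qed
  have single: "is_int_interval {a}" and pair: "is_int_interval {a, a + 1}"
    and triple: "is_int_interval {a, a + 1, a + 2}" for a
  proof -
    have "{a} = {a..a}" "{a, a + 1} = {a..a + 1}" "{a, a + 1, a + 2} = {a..a + 2}" by auto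
    then show "is_int_interval {a}" "is_int_interval {a, a + 1}" "is_int_interval {a, a + 1, a + 2}"
      unfolding is_int_interval_def by (metis le_add1 order_refl)+
  qed
  have "2 ^ (n - 1) + 1 \<le> card ?V"
  proof -
    consider "n = 1" | "n = 2" | "n = 3" using n by linarith
    then show ?thesis
    proof cases
      case 1
      have "{[False], [True]} \<subseteq> ?V"
        using single[of 1] by (simp add: 1 level_color_def remove_nth_def lessThan_Suc)
      then have "card {[False], [True]} \<le> card ?V" by (intro card_mono) auto
      then show ?thesis by (simp add: 1)
    next
      case 2
      have "{[False, False], [True, False], [True, True]} \<subseteq> ?V"
        using pair[of 1] pair[of 2] pair[of 3]
        by (simp add: 2 level_color_def remove_nth_def lessThan_Suc numeral_2_eq_2) (simp add: numeral_eq_Suc insert_commute)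
      then have "card {[False, False], [True, False], [True, True]} \<le> card ?V" by (intro card_mono) auto
      then show ?thesis by (simp add: 2)
    next
      case 3
      let ?W = "{[False, False, False], [True, False, False], [True, True, False], [True, True, True], [False, True, True]}"
      have "?W \<subseteq> ?V"
        using triple[of 1] triple[of 3] triple[of 5] triple[of 7] triple[of 9]
        by (simp add: 3 level_color_def remove_nth_def lessThan_Suc numeral_3_eq_3) (simp add: numeral_eq_Suc insert_commute)
      then have "card ?W \<le> card ?V" by (intro card_mono) auto
      then show ?thesis by (simp add: 3)
    qed
  qed
  moreover obtain \<phi> where "\<phi> \<in> colorings (cube n) t" "interval_count (cube n) \<phi> \<ge> card ?V"
    by (rule level_coloring[OF n(1,3,4), of ?g]) (simp_all add: surj)
  ultimately show ?thesis using that by simp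
qed

lemma many_intervals_coloring:
  assumes n: "1 \<le> n" "n \<le> t" "t \<le> n * 2 ^ (n - 1)"
  obtains \<phi> where "\<phi> \<in> colorings (cube n) t"
    "interval_count (cube n) \<phi> \<ge> 2 ^ (n - 1) + (if n \<le> 3 then 1 else 0)"
proof (cases "n \<le> 3")
  case True
  then show ?thesis using many_intervals_coloring_small[OF n(1) True n(2,3)] that by auto
next
  case False
  then show ?thesis using many_intervals_coloring_even[OF n] that by auto
qed

section \<open>Few colors and few intervals\<close>

lemma le_of_cube_coloring:
  assumes "\<phi> \<in> colorings (cube n) t"
  shows "n \<le> t"
proof -
  let ?x = "replicate n False"
  have "n = card (spectrum (cube n) ?x \<phi>)" using card_spectrum[OF assms, of ?x] by simp
  also have "\<dots> \<le> card {1..t}" using spectrum_subset[OF assms, of ?x] by (intro card_mono) auto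
  finally show ?thesis by simp
qed

lemma interval_count_minimal_palette:
  assumes "\<phi> \<in> colorings (cube n) n" "1 \<le> n"
  shows "interval_count (cube n) \<phi> = 2 ^ n"
proof -
  have "is_int_interval (spectrum (cube n) x \<phi>)" if "length x = n" for x
  proof -
    have "spectrum (cube n) x \<phi> = {1..n}"
      using spectrum_subset[OF assms(1) that] card_spectrum[OF assms(1) that] by (intro card_subset_eq) auto
    then show ?thesis using assms(2) by (auto simp: is_int_interval_def)
  qed
  then have "{x \<in> verts (cube n). is_int_interval (spectrum (cube n) x \<phi>)} = {x. length x = n}"
    by auto
  then show ?thesis by (simp add: interval_count_def card_vertices)
qed

lemma chromatic_index_cube:
  assumes "1 \<le> n"
  shows "chromatic_index (cube n) = n"
  unfolding chromatic_index_def
proof (rule Least_equality)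
  show "colorings (cube n) n \<noteq> {}"
    using many_intervals_coloring_even[of n n] assms by fastforce
qed (use le_of_cube_coloring in blast)

text \<open>Directions \<open>0\<close> and \<open>1\<close> provide the colors \<open>1\<close> and \<open>n + 1\<close> at every vertex, so an interval would have
  to contain all \<open>n + 1\<close> colors. The remaining directions use the colors \<open>2..n - 1\<close> on one facet of
  direction \<open>0\<close> and \<open>3..n\<close> on the other, so that every color occurs somewhere.\<close>
lemma interval_free_coloring:
  assumes n: "3 \<le> n"
  obtains \<phi> where "\<phi> \<in> colorings (cube n) (n + 1)" "interval_count (cube n) \<phi> = 0"
proof -
  define col where "col i x = (if i = 0 then 1 else if i = 1 then n + 1 else if i = 2 \<and> x ! 0 then n else i)"
    for i and x :: "bool list"
  have inj: "inj_on (\<lambda>i. col i x) {..<n}" for x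
  proof (rule inj_onI)
    fix i j assume "i \<in> {..<n}" "j \<in> {..<n}" "col i x = col j x"
    then show "i = j"
      unfolding col_def by (cases "x ! 0") (simp_all split: if_split_asm)
  qed
  have inv: "col i (flip i x) = col i x" if "length x = n" "i < n" for x i
    using that n by (simp add: col_def nth_flip)
  have img: "(\<Union>x\<in>{x. length x = n}. (\<lambda>i. col i x) ` {..<n}) = {1..n + 1}"
  proof (intro subset_antisym subsetI)
    fix c assume c: "c \<in> {1..n + 1}"
    \<comment> \<open>color \<open>n\<close> is found on the facet where coordinate \<open>0\<close> is set, every other color on the opposite one\<close>
    define x where "x = replicate n (c = n)"
    define i where "i = (if c = 1 then 0 else if c = n + 1 then 1 else if c = n then 2 else c)"
    have "col i x = c" "i < n" "length x = n"
      using c n by (auto simp: col_def i_def x_def)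
    then show "c \<in> (\<Union>x\<in>{x. length x = n}. (\<lambda>i. col i x) ` {..<n})" by blast
  qed (use n in \<open>auto simp: col_def split: if_splits\<close>)
  obtain \<phi> where \<phi>: "\<phi> \<in> colorings (cube n) (n + 1)"
    and spec: "\<And>x. length x = n \<Longrightarrow> spectrum (cube n) x \<phi> = (\<lambda>i. col i x) ` {..<n}"
    using coloring_from_directions[OF inv inj img] by blast
  have "\<not> is_int_interval (spectrum (cube n) x \<phi>)" if x: "length x = n" for x
  proof
    assume "is_int_interval (spectrum (cube n) x \<phi>)"
    then obtain a b where ab: "(\<lambda>i. col i x) ` {..<n} = {a..b}"
      using spec[OF x] by (auto simp: is_int_interval_def)
    have "col 0 x \<in> (\<lambda>i. col i x) ` {..<n}" "col 1 x \<in> (\<lambda>i. col i x) ` {..<n}" using n by auto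
    then have "{1..n + 1} \<subseteq> {a..b}" unfolding ab by (auto simp: col_def)
    then have "(if x ! 0 then 2 else n) \<in> (\<lambda>i. col i x) ` {..<n}"
      unfolding ab using n by auto
    then show False using n by (auto simp: col_def split: if_splits)
  qed
  then have "interval_count (cube n) \<phi> = 0"
    by (auto simp: interval_count_def)
  then show ?thesis using \<phi> that by blast
qed

lemma is_int_interval_pair:
  "is_int_interval {a, b} \<longleftrightarrow> a \<le> b + 1 \<and> b \<le> a + 1"
proof
  assume "is_int_interval {a, b}"
  then obtain c d where cd: "{a, b} = {c..d}" by (auto simp: is_int_interval_def)
  have "card {c..d} \<le> 2" unfolding cd[symmetric] by (simp add: card_insert_if)
  moreover have "a \<in> {c..d}" "b \<in> {c..d}" unfolding cd[symmetric] by auto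
  ultimately show "a \<le> b + 1 \<and> b \<le> a + 1" by auto
next
  assume "a \<le> b + 1 \<and> b \<le> a + 1"
  then have "{a, b} = {min a b..max a b}" by auto
  then show "is_int_interval {a, b}" unfolding is_int_interval_def by (metis max.cobounded1 min.cobounded1 order_trans)
qed

lemma square_vertices:
  "{x :: bool list. length x = 2} = {[False, False], [True, False], [True, True], [False, True]}"
  by (auto simp: length_Suc_conv numeral_2_eq_2)

text \<open>Let \<open>a, b, c, d\<close> be the colors around a square. If both neighbors of the edge of color \<open>2\<close> avoid
  \<open>1\<close> and \<open>3\<close> they have color \<open>4\<close>, and the opposite edge alone would have to supply \<open>1\<close> and \<open>3\<close>.\<close>
lemma neighbours_of_color_2:
  fixes a b c d t :: nat
  assumes pal: "{a, b, c, d} = {1..t}" and "a = 2" and far: "\<not> (a \<le> b + 1 \<and> b \<le> a + 1)"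
  shows "d \<le> a + 1 \<and> a \<le> d + 1"
proof (rule ccontr)
  assume d: "\<not> (d \<le> a + 1 \<and> a \<le> d + 1)"
  have "card {a, b, c, d} \<le> 4" by (simp add: card_insert_if)
  then have "t \<le> 4" unfolding pal by simp
  moreover have "b \<in> {1..t}" "d \<in> {1..t}" unfolding pal[symmetric] by simp_all
  ultimately have "b = 4" "d = 4" "t = 4" using far d \<open>a = 2\<close> by auto
  then have "1 \<in> {a, b, c, d}" "3 \<in> {a, b, c, d}" unfolding pal by simp_all
  then show False using \<open>a = 2\<close> \<open>b = 4\<close> \<open>d = 4\<close> by auto
qed

text \<open>Two adjacent edges have different colors, so color \<open>2\<close> is used, and the edges next to it are
  covered by the preceding lemma, up to a rotation of the square.\<close>
lemma square_has_interval_vertex: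
  assumes \<phi>: "\<phi> \<in> colorings (cube 2) t"
  shows "1 \<le> interval_count (cube 2) \<phi>"
proof (rule ccontr)
  assume "\<not> 1 \<le> interval_count (cube 2) \<phi>"
  then have "{x \<in> verts (cube 2). is_int_interval (spectrum (cube 2) x \<phi>)} = {}"
    unfolding interval_count_def by (subst (asm) not_le) (simp add: card_eq_0_iff)
  then have none: "\<not> is_int_interval (spectrum (cube 2) x \<phi>)" if "length x = 2" for x
    using that by auto
  let ?a = "\<phi> {[False, False], [True, False]}" and ?b = "\<phi> {[True, False], [True, True]}"
  let ?c = "\<phi> {[True, True], [False, True]}" and ?d = "\<phi> {[False, True], [False, False]}"
  have far: "\<not> (?a \<le> ?b + 1 \<and> ?b \<le> ?a + 1)" "\<not> (?b \<le> ?c + 1 \<and> ?c \<le> ?b + 1)"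
    "\<not> (?c \<le> ?d + 1 \<and> ?d \<le> ?c + 1)" "\<not> (?d \<le> ?a + 1 \<and> ?a \<le> ?d + 1)"
    using none[of "[True, False]"] none[of "[True, True]"] none[of "[False, True]"] none[of "[False, False]"]
    unfolding is_int_interval_pair[symmetric]
    by (simp_all add: spectrum_cube numeral_2_eq_2 lessThan_Suc insert_commute)
  have "edges (cube 2) = {{[False, False], [True, False]}, {[True, False], [True, True]},
      {[True, True], [False, True]}, {[False, True], [False, False]}}"
  proof (intro subset_antisym subsetI)
    fix e assume "e \<in> edges (cube 2)"
    then obtain x i where e: "e = {x, flip i x}" "length x = 2" and i: "i = 0 \<or> i = 1"
      by (auto simp: edges_cube less_2_cases_iff)
    have "x \<in> {[False, False], [True, False], [True, True], [False, True]}"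
      using e(2) square_vertices by blast
    with i have "{x, flip i x} \<in> {{[False, False], [True, False]}, {[True, False], [True, True]},
        {[True, True], [False, True]}, {[False, True], [False, False]}}"
      by (elim disjE insertE emptyE) (simp_all add: doubleton_eq_iff)
    then show "e \<in> {{[False, False], [True, False]}, {[True, False], [True, True]},
        {[True, True], [False, True]}, {[False, True], [False, False]}}"
      by (simp only: e(1))
  next
    fix e :: "bool list set"
    assume "e \<in> {{[False, False], [True, False]}, {[True, False], [True, True]},
      {[True, True], [False, True]}, {[False, True], [False, False]}}"
    then show "e \<in> edges (cube 2)"
      using edge_in_cube[of "[False, False]" 2 0] edge_in_cube[of "[True, False]" 2 1]
        edge_in_cube[of "[True, True]" 2 0] edge_in_cube[of "[False, True]" 2 1]
      by auto
  qed
  then have used: "{?a, ?b, ?c, ?d} = {1..t}"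
    using \<phi> by (simp add: colorings_def)
  have "?a \<noteq> ?b" using far(1) by auto
  moreover have "?a \<in> {1..t}" "?b \<in> {1..t}" unfolding used[symmetric] by simp_all
  ultimately have "2 \<in> {1..t}" by auto
  then consider "?a = 2" | "?b = 2" | "?c = 2" | "?d = 2"
    unfolding used[symmetric] by auto
  then show False
  proof cases
    case 1
    then show ?thesis using neighbours_of_color_2[of ?a ?b ?c ?d t] used far by simp
  next
    case 2
    then show ?thesis using neighbours_of_color_2[of ?b ?c ?d ?a t] used far by (simp add: insert_commute)
  next
    case 3
    then show ?thesis using neighbours_of_color_2[of ?c ?d ?a ?b t] used far by (simp add: insert_commute)
  next
    case 4
    then show ?thesis using neighbours_of_color_2[of ?d ?a ?b ?c t] used far by (simp add: insert_commute)
  qed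
qed

text \<open>The colors around the square are \<open>1, 3, 2, 4\<close>; only \<open>3\<close> and \<open>2\<close> are consecutive.\<close>
lemma square_coloring_with_one_interval:
  obtains \<phi> where "\<phi> \<in> colorings (cube 2) 4" "interval_count (cube 2) \<phi> \<le> 1"
proof -
  define col :: "nat \<Rightarrow> bool list \<Rightarrow> nat"
    where "col i x = (if i = 0 then if x ! 1 then 2 else 1 else if x ! 0 then 3 else 4)" for i x
  have img: "(\<Union>x\<in>{x. length x = 2}. (\<lambda>i. col i x) ` {..<2}) = {1..4}"
    unfolding square_vertices by (auto simp: col_def numeral_2_eq_2 lessThan_Suc)
  have inj: "inj_on (\<lambda>i. col i x) {..<2}" for x
    by (auto simp: col_def inj_on_def)
  have inv: "col i (flip i x) = col i x" if "length x = 2" "i < 2" for i x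
    using that by (auto simp: col_def nth_flip less_2_cases_iff)
  obtain \<phi> where \<phi>: "\<phi> \<in> colorings (cube 2) 4"
    and spec: "\<And>x. length x = 2 \<Longrightarrow> spectrum (cube 2) x \<phi> = (\<lambda>i. col i x) ` {..<2}"
    using coloring_from_directions[OF inv inj img] by blast
  have "x = [True, True]" if x: "length x = 2" "is_int_interval (spectrum (cube 2) x \<phi>)" for x
  proof -
    have "{..<2::nat} = {0, 1}" by auto
    then have "is_int_interval {col 0 x, col 1 x}"
      using x by (simp add: spec)
    moreover have "x \<in> {[False, False], [True, False], [True, True], [False, True]}"
      using x(1) square_vertices by blast
    ultimately show ?thesis
      by (elim insertE emptyE) (simp_all add: is_int_interval_pair col_def)
  qed
  then have "{x \<in> verts (cube 2). is_int_interval (spectrum (cube 2) x \<phi>)} \<subseteq> {[True, True]}"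
    by auto
  then have "card {x \<in> verts (cube 2). is_int_interval (spectrum (cube 2) x \<phi>)} \<le> card {[True, True]}"
    by (intro card_mono) auto
  then show ?thesis using \<phi> that by (simp add: interval_count_def)
qed

section \<open>The four parameters\<close>

lemma finite_interval_counts: "finite (interval_count (cube n) ` colorings (cube n) t)"
  by (rule finite_subset[of _ "{..2 ^ n}"]) (simp_all add: image_subset_iff interval_count_le)

lemma mu1_le: "\<phi> \<in> colorings (cube n) t \<Longrightarrow> mu1 (cube n) t \<le> interval_count (cube n) \<phi>"
  unfolding mu1_def using finite_interval_counts by (intro Min_le) auto

lemma mu2_ge: "\<phi> \<in> colorings (cube n) t \<Longrightarrow> interval_count (cube n) \<phi> \<le> mu2 (cube n) t"
  unfolding mu2_def using finite_interval_counts by (intro Max_ge) auto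

lemma mu1_attained:
  assumes "colorings (cube n) t \<noteq> {}"
  obtains \<phi> where "\<phi> \<in> colorings (cube n) t" "mu1 (cube n) t = interval_count (cube n) \<phi>"
  unfolding mu1_def using Min_in[OF finite_interval_counts, of n t] assms that by blast

lemma mu2_attained:
  assumes "colorings (cube n) t \<noteq> {}"
  obtains \<phi> where "\<phi> \<in> colorings (cube n) t" "mu2 (cube n) t = interval_count (cube n) \<phi>"
  unfolding mu2_def using Max_in[OF finite_interval_counts, of n t] assms that by blast

theorem theorem1:
  fixes n :: nat
  assumes "n \<ge> 1"
  shows "mu11 (cube n) = 3 - min 3 n
    \<and> mu12 (cube n) = 2 ^ n
    \<and> mu22 (cube n) = 2 ^ n
    \<and> int (mu21 (cube n)) = 2 ^ (n - 1) + \<lceil>1 - real (min 4 n) / 4\<rceil>"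
proof -
  define R where "R = {n..card (edges (cube n))}"
  have E: "card (edges (cube n)) = n * 2 ^ (n - 1)" by (rule card_edges_cube[OF assms])
  have inR: "n \<in> R" "card (edges (cube n)) \<in> R" and finR: "finite R" by (auto simp: R_def E)
  have ne: "colorings (cube n) t \<noteq> {}" if "t \<in> R" for t
    using many_intervals_coloring_even[OF assms, of t] that by (auto simp: R_def E)
  have mu1_le_2n: "mu1 (cube n) t \<le> 2 ^ n" if "t \<in> R" for t
    using mu1_attained[OF ne[OF that]] interval_count_le by metis
  have mu2_le_2n: "mu2 (cube n) t \<le> 2 ^ n" if "t \<in> R" for t
    using mu2_attained[OF ne[OF that]] interval_count_le by metis
  have mu1_n: "mu1 (cube n) n = 2 ^ n"
    using mu1_attained[OF ne[OF inR(1)]] interval_count_minimal_palette assms by metis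
  have mu2_n: "mu2 (cube n) n = 2 ^ n"
    using mu2_attained[OF ne[OF inR(1)]] interval_count_minimal_palette assms by metis
  have mu12: "mu12 (cube n) = 2 ^ n"
    unfolding mu12_def chromatic_index_cube[OF assms] R_def[symmetric]
    using mu1_le_2n mu1_n inR(1) finR by (intro Max_eqI) force+
  have mu22: "mu22 (cube n) = 2 ^ n"
    unfolding mu22_def chromatic_index_cube[OF assms] R_def[symmetric]
    using mu2_le_2n mu2_n inR(1) finR by (intro Max_eqI) force+
  have mu11: "mu11 (cube n) = 3 - min 3 n"
  proof -
    have min: "mu11 (cube n) = k" if "t \<in> R" "mu1 (cube n) t \<le> k" "\<And>t. t \<in> R \<Longrightarrow> k \<le> mu1 (cube n) t" for k t
    proof -
      have "mu1 (cube n) t = k" using that by (meson le_antisym)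
      then show ?thesis
        unfolding mu11_def chromatic_index_cube[OF assms] R_def[symmetric]
        using that finR by (intro Min_eqI) force+
    qed
    consider "n = 1" | "n = 2" | "n \<ge> 3" using assms by linarith
    then show ?thesis
    proof cases
      case 1
      then have "R = {1}" using E by (auto simp: R_def)
      then have "mu11 (cube n) = 2" using mu1_n 1 by (intro min[of 1]) auto
      then show ?thesis using 1 by simp
    next
      case 2
      obtain \<phi> where \<phi>: "\<phi> \<in> colorings (cube 2) 4" "interval_count (cube 2) \<phi> \<le> 1"
        by (rule square_coloring_with_one_interval)
      have "mu11 (cube n) = 1"
      proof (rule min[of 4])
        show "4 \<in> R" using E 2 by (simp add: R_def)
        show "mu1 (cube n) 4 \<le> 1" using mu1_le[OF \<phi>(1)] \<phi>(2) 2 by simp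
        show "1 \<le> mu1 (cube n) t" if "t \<in> R" for t
          using mu1_attained[OF ne[OF that]] square_has_interval_vertex 2 by metis
      qed
      then show ?thesis using 2 by simp
    next
      case 3
      obtain \<phi> where \<phi>: "\<phi> \<in> colorings (cube n) (n + 1)" "interval_count (cube n) \<phi> = 0"
        by (rule interval_free_coloring[OF 3])
      have "(2::nat) ^ 1 \<le> 2 ^ (n - 1)" using 3 by (intro power_increasing) auto
      then have "n * 2 \<le> card (edges (cube n))" unfolding E by (intro mult_le_mono2) simp
      then have "n + 1 \<in> R" using 3 by (simp add: R_def)
      then have "mu11 (cube n) = 0"
        using mu1_le[OF \<phi>(1)] \<phi>(2) by (intro min[of "n + 1"]) auto
      then show ?thesis using 3 by simp
    qed
  qed
  let ?B = "2 ^ (n - 1) + (if n \<le> 3 then 1 else 0)"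
  have "mu21 (cube n) = ?B"
  proof -
    have lower: "?B \<le> mu2 (cube n) t" if "t \<in> R" for t
      using many_intervals_coloring[OF assms, of t] mu2_ge that unfolding R_def E
      by (metis atLeastAtMost_iff le_trans)
    have "mu2 (cube n) (card (edges (cube n))) \<le> ?B"
      using mu2_attained[OF ne[OF inR(2)]] rainbow_interval_count_le assms by metis
    then have "mu2 (cube n) (card (edges (cube n))) = ?B" using lower[OF inR(2)] by linarith
    then show ?thesis
      unfolding mu21_def chromatic_index_cube[OF assms] R_def[symmetric]
      using lower inR(2) finR by (intro Min_eqI) force+
  qed
  moreover have "\<lceil>1 - real (min 4 n) / 4\<rceil> = (if n \<le> 3 then 1 else 0)"
    using assms by (auto simp: ceiling_eq_iff)
  ultimately have "int (mu21 (cube n)) = 2 ^ (n - 1) + \<lceil>1 - real (min 4 n) / 4\<rceil>"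
    by simp
  then show ?thesis using mu11 mu12 mu22 by blast
qed

end
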